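(* A real $\alpha\in(0,1)$ is left-c.e. speedable if and only if it is covered by a Solovay test that has bounded increments.
   Context: Conventions: "real" means a real number in the open interval $(0,1)$. An approximation of a real $\alpha$ is a sequence $\{a_s\}_{s\in\omega}$ of rational numbers in $[0,1]$ converging to $\alpha$. It is computable if $a_s$ can be computed from $s$. A computable approximation is left-c.e. if it is nondecreasing. A computable order is a computable function $f:\mathbb N\to\mathbb N$ that is nondecreasing and unbounded. Let $\{a_s\}_{s\in\omega}$ be a computable approximation of $\alpha$ and let $\rho\in[0,1)$ be rational. The approximation is $\rho$-speedable if either $\alpha$ is rational, or $\alpha$ is irrational and there is a computable order $f$ with $$\liminf_{s\to\infty}\left|\frac{\alpha-a_{f(s)}}{\alpha-a_s}\right|\le\rho .$$ It is speedable if it is $\rho$-speedable for some $\rho\in[0,1)$. A real is left-c.e. speedable if it has a left-c.e. approximation that is speedable. Solovay tests: a Solovay test is a sequence $\{[\ell_i,r_i]\}_{i\in\omega}$ of nonempty closed intervals (so $0\le \ell_i\le r_i\le 1$) such that $\{\ell_i\}_{i\in\omega}$ and $\{r_i\}_{i\in\omega}$ are computable sequences of dyadic rationals in $[0,1]$ and $\sum_i(r_i-\ell_i)<\infty$. A real $\gamma$ is covered by the test if $\gamma\in[\ell_i,r_i]$ for infinitely many $i$. The test has bounded increments if for some rational constant $d>0$ it holds for all $i$ that $\ell_{i+1}\ge \ell_i+d(r_i-\ell_i)$. *)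

theory Defs
  imports Complex_Main "HOL-Library.Extended_Real"
begin

section \<open>Computable functions\<close>

text \<open>
  Kleene's partial recursive functions, as programs with a big-step semantics:
  \<open>evals p xs y\<close> means that \<open>p\<close> halts on the argument list \<open>xs\<close> with output \<open>y\<close>.
  Arities are not tracked; a program applied to too short a list simply has no value,
  and surplus arguments are ignored by \<open>Zero\<close> and \<open>Succ\<close>.
  In \<open>PrimRec\<close> and \<open>Mu\<close> the recursion (search) variable is the first argument.
\<close>

datatype recf =
    Zero
  | Succ
  | Proj nat
  | Comp recf "recf list"
  | PrimRec recf recf
  | Mu recf

inductive evals :: "recf \<Rightarrow> nat list \<Rightarrow> nat \<Rightarrow> bool" where
  Zero: "evals Zero xs 0"
| Succ: "evals Succ (x # xs) (Suc x)"
| Proj: "i < length xs \<Longrightarrow> evals (Proj i) xs (xs ! i)"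
| Comp: "list_all2 (\<lambda>g y. evals g xs y) gs ys \<Longrightarrow> evals f ys z \<Longrightarrow> evals (Comp f gs) xs z"
| PrimRec_0: "evals f xs y \<Longrightarrow> evals (PrimRec f g) (0 # xs) y"
| PrimRec_Suc: "evals (PrimRec f g) (n # xs) y \<Longrightarrow> evals g (n # y # xs) z
    \<Longrightarrow> evals (PrimRec f g) (Suc n # xs) z"
| Mu: "evals f (n # xs) 0 \<Longrightarrow> (\<And>m. m < n \<Longrightarrow> \<exists>k. evals f (m # xs) (Suc k))
    \<Longrightarrow> evals (Mu f) xs n"

inductive_cases evals_ZeroE: "evals Zero xs y"
inductive_cases evals_SuccE: "evals Succ xs y"
inductive_cases evals_ProjE: "evals (Proj i) xs y"
inductive_cases evals_CompE: "evals (Comp f gs) xs y"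
inductive_cases evals_PrimRec_0E: "evals (PrimRec f g) (0 # xs) y"
inductive_cases evals_PrimRec_SucE: "evals (PrimRec f g) (Suc n # xs) y"
inductive_cases evals_MuE: "evals (Mu f) xs y"

lemma evals_deterministic: "evals p xs y \<Longrightarrow> evals p xs z \<Longrightarrow> y = z"
proof (induction arbitrary: z rule: evals.induct)
  case (Zero xs)
  then show ?case by (rule evals_ZeroE) simp
next
  case (Succ x xs)
  then show ?case by (rule evals_SuccE) simp
next
  case (Proj i xs)
  from Proj.prems show ?case by (rule evals_ProjE) simp
next
  case (Comp xs gs ys f y)
  from Comp.prems obtain ys' where
    ys': "list_all2 (\<lambda>g y. evals g xs y) gs ys'" "evals f ys' z"
    by (rule evals_CompE)
  have "ys = ys'"
  proof (rule nth_equalityI)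
    show "length ys = length ys'"
      by (rule trans[OF list_all2_lengthD[OF Comp.IH(1), symmetric] list_all2_lengthD[OF ys'(1)]])
    show "ys ! i = ys' ! i" if "i < length ys" for i
    proof -
      have i: "i < length gs" using that list_all2_lengthD[OF Comp.IH(1)] by simp
      have "\<forall>z. evals (gs ! i) xs z \<longrightarrow> ys ! i = z"
        using list_all2_nthD[OF Comp.IH(1) i] by blast
      moreover have "evals (gs ! i) xs (ys' ! i)" by (rule list_all2_nthD[OF ys'(1) i])
      ultimately show ?thesis by blast
    qed
  qed
  with ys'(2) show ?case by (intro Comp.IH(2)) simp
next
  case (PrimRec_0 f xs y g)
  from PrimRec_0.prems have "evals f xs z" by (rule evals_PrimRec_0E)
  then show ?case by (rule PrimRec_0.IH)
next
  case (PrimRec_Suc f g n xs y y')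
  from PrimRec_Suc.prems obtain r where
    r: "evals (PrimRec f g) (n # xs) r" "evals g (n # r # xs) z"
    by (rule evals_PrimRec_SucE)
  have "y = r" by (rule PrimRec_Suc.IH(1)[OF r(1)])
  with r(2) show ?case by (intro PrimRec_Suc.IH(2)) simp
next
  case (Mu f n xs)
  from Mu.prems have z: "evals f (z # xs) 0" "\<And>m. m < z \<Longrightarrow> \<exists>k. evals f (m # xs) (Suc k)"
    by (auto elim!: evals_MuE)
  show ?case
  proof (rule linorder_cases[of n z])
    assume "n < z"
    then obtain k where "evals f (n # xs) (Suc k)" using z(2) by blast
    then have "0 = Suc k" by (rule Mu.IH(1))
    then show ?thesis by simp
  next
    assume "z < n"
    then obtain k where "\<forall>x. evals f (z # xs) x \<longrightarrow> Suc k = x" using Mu.IH(2) by blast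
    then have "Suc k = 0" using z(1) by blast
    then show ?thesis by simp
  qed simp
qed

definition computable :: "(nat \<Rightarrow> nat) \<Rightarrow> bool" where
  "computable f \<longleftrightarrow> (\<exists>p. \<forall>n. evals p [n] (f n))"

text \<open>A rational is computed as a sign together with a (not necessarily reduced) fraction.\<close>

definition computable_rat_seq :: "(nat \<Rightarrow> rat) \<Rightarrow> bool" where
  "computable_rat_seq a \<longleftrightarrow>
     (\<exists>\<sigma> p q. computable \<sigma> \<and> computable p \<and> computable q \<and>
        (\<forall>s. q s \<noteq> 0 \<and> a s = (- 1) ^ \<sigma> s * (of_nat (p s) / of_nat (q s))))"

definition computable_order :: "(nat \<Rightarrow> nat) \<Rightarrow> bool" where
  "computable_order f \<longleftrightarrow> computable f \<and> mono f \<and> (\<forall>b. \<exists>n. b < f n)"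


section \<open>Speedability\<close>

definition approximates :: "(nat \<Rightarrow> rat) \<Rightarrow> real \<Rightarrow> bool" where
  "approximates a \<alpha> \<longleftrightarrow>
     (\<forall>s. 0 \<le> a s \<and> a s \<le> 1) \<and> (\<lambda>s. real_of_rat (a s)) \<longlonglongrightarrow> \<alpha>"

definition computable_approx :: "(nat \<Rightarrow> rat) \<Rightarrow> real \<Rightarrow> bool" where
  "computable_approx a \<alpha> \<longleftrightarrow> approximates a \<alpha> \<and> computable_rat_seq a"

definition left_ce_approx :: "(nat \<Rightarrow> rat) \<Rightarrow> real \<Rightarrow> bool" where
  "left_ce_approx a \<alpha> \<longleftrightarrow> computable_approx a \<alpha> \<and> mono a"

text \<open>
  The limit inferior is taken in the extended reals, since the quotients need not be bounded.
  For irrational \<open>\<alpha>\<close> the denominator never vanishes.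
\<close>

definition rho_speedable :: "rat \<Rightarrow> (nat \<Rightarrow> rat) \<Rightarrow> real \<Rightarrow> bool" where
  "rho_speedable \<rho> a \<alpha> \<longleftrightarrow>
     \<alpha> \<in> \<rat> \<or>
     (\<alpha> \<notin> \<rat> \<and>
      (\<exists>f. computable_order f \<and>
         liminf (\<lambda>s. ereal \<bar>(\<alpha> - real_of_rat (a (f s))) / (\<alpha> - real_of_rat (a s))\<bar>)
           \<le> ereal (real_of_rat \<rho>)))"

definition speedable :: "(nat \<Rightarrow> rat) \<Rightarrow> real \<Rightarrow> bool" where
  "speedable a \<alpha> \<longleftrightarrow> (\<exists>\<rho>. 0 \<le> \<rho> \<and> \<rho> < 1 \<and> rho_speedable \<rho> a \<alpha>)"

definition left_ce_speedable :: "real \<Rightarrow> bool" where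
  "left_ce_speedable \<alpha> \<longleftrightarrow> (\<exists>a. left_ce_approx a \<alpha> \<and> speedable a \<alpha>)"


section \<open>Solovay tests\<close>

definition dyadic :: "rat \<Rightarrow> bool" where
  "dyadic x \<longleftrightarrow> (\<exists>(m::int) (k::nat). x = of_int m / 2 ^ k)"

definition solovay_test :: "(nat \<Rightarrow> rat) \<Rightarrow> (nat \<Rightarrow> rat) \<Rightarrow> bool" where
  "solovay_test l r \<longleftrightarrow>
     (\<forall>i. 0 \<le> l i \<and> l i \<le> r i \<and> r i \<le> 1 \<and> dyadic (l i) \<and> dyadic (r i)) \<and>
     computable_rat_seq l \<and> computable_rat_seq r \<and>
     summable (\<lambda>i. real_of_rat (r i - l i))"

definition covered_by :: "real \<Rightarrow> (nat \<Rightarrow> rat) \<Rightarrow> (nat \<Rightarrow> rat) \<Rightarrow> bool" where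
  "covered_by \<gamma> l r \<longleftrightarrow> infinite {i. \<gamma> \<in> {real_of_rat (l i)..real_of_rat (r i)}}"

definition bounded_increments :: "(nat \<Rightarrow> rat) \<Rightarrow> (nat \<Rightarrow> rat) \<Rightarrow> bool" where
  "bounded_increments l r \<longleftrightarrow> (\<exists>d>0. \<forall>i. l (Suc i) \<ge> l i + d * (r i - l i))"

end

theory Submission
  imports Defs
begin

text \<open>
  For a nondecreasing approximation \<open>a\<close>, the inequality
  \<open>\<alpha> - a (f s) \<le> \<rho> * (\<alpha> - a s)\<close> says that \<open>\<alpha>\<close> lies in the interval that starts at \<open>a s\<close>
  and is \<open>1 / (1 - \<rho>)\<close> times as long as the step from \<open>a s\<close> to \<open>a (f s)\<close>.
  So the left endpoints of a test with bounded increments form an approximation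
  that is speeded up by the successor function. Conversely, let \<open>f\<close> speed up \<open>a\<close>, and
  iterate \<open>f\<close> from \<open>0\<close>. By monotonicity of \<open>f\<close>, two consecutive steps of this iteration
  contain the step from \<open>s\<close> to \<open>f s\<close> for any given \<open>s\<close>, so one of the two makes enough
  progress; the steps telescope, hence the stretched intervals have finite total length.
  To get dyadic endpoints, \<open>a s\<close> is first rounded to a multiple of \<open>1 / 2 ^ s\<close> that is at least
  \<open>1 / 2 ^ s\<close> and at most \<open>2 / 2 ^ s\<close> below \<open>a s\<close>; a good \<open>s\<close> stays good if \<open>f s\<close> exceeds \<open>s\<close> by
  a sufficiently large constant. This also covers rational \<open>\<alpha>\<close>, with \<open>a\<close> constant.
\<close>

section \<open>Recursion theory: programs for recursion, arithmetic and rational sequences\<close>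

section \<open>Closure properties of computable functions\<close>

text \<open>Arithmetic and recursion with a parameter take two arguments, whereas
  \<open>computable\<close> speaks of one only.\<close>

definition computable2 :: "(nat \<Rightarrow> nat \<Rightarrow> nat) \<Rightarrow> bool" where
  "computable2 F \<longleftrightarrow> (\<exists>p. \<forall>x y. evals p [x, y] (F x y))"

lemma evals_Proj: "i < length xs \<Longrightarrow> y = xs ! i \<Longrightarrow> evals (Proj i) xs y"
  by (simp add: evals.Proj)

lemma evals_Comp1: "evals g xs y \<Longrightarrow> evals f [y] z \<Longrightarrow> evals (Comp f [g]) xs z"
  by (rule evals.Comp[of xs _ "[y]"]) auto

lemma evals_Comp2:
  "evals g xs y \<Longrightarrow> evals h xs y' \<Longrightarrow> evals f [y, y'] z \<Longrightarrow> evals (Comp f [g, h]) xs z"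
  by (rule evals.Comp[of xs _ "[y, y']"]) auto

text \<open>The step of \<open>rec_nat\<close> takes counter and previous value in the order in
  which \<open>PrimRec\<close> passes them. Computability thus reduces to identifying a
  \<open>rec_nat\<close> term with the intended function.\<close>

lemma evals_PrimRec_rec_nat:
  assumes "evals f xs z" "\<And>n y. evals g (n # y # xs) (h n y)"
  shows "evals (PrimRec f g) (n # xs) (rec_nat z h n)"
proof (induction n)
  case 0
  show ?case using assms(1) by (simp add: evals.PrimRec_0)
next
  case (Suc n)
  show ?case using evals.PrimRec_Suc[OF Suc assms(2)] by simp
qed

lemma evals_const: "\<exists>p. \<forall>xs. evals p xs c"
proof (induction c)
  case 0
  show ?case using evals.Zero by blast
next
  case (Suc c)
  then obtain p where "\<forall>xs. evals p xs c" by blast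
  then have "\<forall>xs. evals (Comp Succ [p]) xs (Suc c)"
    by (auto intro: evals_Comp1[OF _ evals.Succ])
  then show ?case by blast
qed

lemma computable_const: "computable (\<lambda>n. c)"
  using evals_const[of c] unfolding computable_def by blast

lemma computable_id: "computable (\<lambda>n. n)"
  unfolding computable_def by (rule exI[of _ "Proj 0"]) (simp add: evals_Proj)

lemma computable_comp:
  assumes "computable f" "computable g"
  shows "computable (\<lambda>n. f (g n))"
proof -
  obtain p where "\<And>n. evals p [n] (f n)" using assms(1) unfolding computable_def by blast
  moreover obtain q where "\<And>n. evals q [n] (g n)" using assms(2) unfolding computable_def by blast
  ultimately have "evals (Comp p [q]) [n] (f (g n))" for n by (blast intro: evals_Comp1)
  then show ?thesis unfolding computable_def by blast
qed

lemma computable_comp2: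
  assumes "computable2 F" "computable f" "computable g"
  shows "computable (\<lambda>n. F (f n) (g n))"
proof -
  obtain p where "\<And>x y. evals p [x, y] (F x y)" using assms(1) unfolding computable2_def by blast
  moreover obtain q where "\<And>n. evals q [n] (f n)" using assms(2) unfolding computable_def by blast
  moreover obtain r where "\<And>n. evals r [n] (g n)" using assms(3) unfolding computable_def by blast
  ultimately have "evals (Comp p [q, r]) [n] (F (f n) (g n))" for n by (blast intro: evals_Comp2)
  then show ?thesis unfolding computable_def by blast
qed

lemma computable2_comp2:
  assumes "computable2 F" "computable2 f" "computable2 g"
  shows "computable2 (\<lambda>x y. F (f x y) (g x y))"
proof -
  obtain p where "\<And>x y. evals p [x, y] (F x y)" using assms(1) unfolding computable2_def by blast
  moreover obtain q where "\<And>x y. evals q [x, y] (f x y)"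
    using assms(2) unfolding computable2_def by blast
  moreover obtain r where "\<And>x y. evals r [x, y] (g x y)"
    using assms(3) unfolding computable2_def by blast
  ultimately have "evals (Comp p [q, r]) [x, y] (F (f x y) (g x y))" for x y
    by (blast intro: evals_Comp2)
  then show ?thesis unfolding computable2_def by blast
qed

lemma computable2_swap:
  assumes "computable2 F"
  shows "computable2 (\<lambda>x y. F y x)"
proof -
  have "computable2 (\<lambda>x y. y)" "computable2 (\<lambda>x y. x)"
    unfolding computable2_def
    by (rule exI[of _ "Proj 1"], simp add: evals_Proj) (rule exI[of _ "Proj 0"], simp add: evals_Proj)
  with assms show ?thesis by (rule computable2_comp2)
qed

lemma computable_Suc: "computable Suc"
  unfolding computable_def using evals.Succ by blast

lemma computable_funpow:
  assumes "computable g"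
  shows "computable (\<lambda>n. (g ^^ n) c)"
proof -
  obtain p where p: "\<And>n. evals p [n] (g n)" using assms unfolding computable_def by blast
  obtain q where q: "\<And>xs. evals q xs c" using evals_const by blast
  have "evals (PrimRec q (Comp p [Proj 1])) [n] (rec_nat c (\<lambda>_. g) n)" for n
    by (intro evals_PrimRec_rec_nat q evals_Comp1[OF _ p] evals_Proj) simp_all
  moreover have "rec_nat c (\<lambda>_. g) n = (g ^^ n) c" for n
    by (induction n) simp_all
  ultimately show ?thesis unfolding computable_def by metis
qed

text \<open>Sum, product, power and truncated difference all iterate a simpler operation with a
  fixed parameter \<open>x\<close>, so the step may ignore the counter. The recursion variable comes
  first, hence the swaps for power and difference.\<close>

lemma computable2_rec:
  assumes z: "computable z" and h: "computable2 h"
  shows "computable2 (\<lambda>n x. rec_nat (z x) (\<lambda>_ y. h y x) n)"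
proof -
  obtain p where p: "\<And>n. evals p [n] (z n)" using z unfolding computable_def by blast
  obtain q where q: "\<And>x y. evals q [x, y] (h x y)" using h unfolding computable2_def by blast
  have "evals (PrimRec p (Comp q [Proj 1, Proj 2])) [n, x] (rec_nat (z x) (\<lambda>_ y. h y x) n)" for n x
    by (intro evals_PrimRec_rec_nat p evals_Comp2[OF _ _ q] evals_Proj) simp_all
  then show ?thesis unfolding computable2_def by blast
qed

lemma computable2_fst:
  assumes "computable f"
  shows "computable2 (\<lambda>x y. f x)"
proof -
  obtain p where p: "\<And>n. evals p [n] (f n)" using assms unfolding computable_def by blast
  have "evals (Comp p [Proj 0]) [x, y] (f x)" for x y
    by (intro evals_Comp1[OF _ p] evals_Proj) simp_all
  then show ?thesis unfolding computable2_def by blast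
qed

section \<open>Arithmetic on natural numbers\<close>

lemma computable2_add: "computable2 (+)"
proof -
  have "rec_nat x (\<lambda>_ y. Suc y) n = n + x" for n x by (induction n) simp_all
  then show ?thesis
    using computable2_rec[OF computable_id computable2_fst[OF computable_Suc]] by simp
qed

lemma computable2_mult: "computable2 (*)"
proof -
  have "rec_nat 0 (\<lambda>_ y. y + x) n = n * x" for n x :: nat by (induction n) simp_all
  then show ?thesis
    using computable2_rec[OF computable_const computable2_add, of 0] by simp
qed

lemma computable2_power: "computable2 (^)"
proof -
  have "rec_nat 1 (\<lambda>_ y. y * x) n = x ^ n" for n x :: nat by (induction n) simp_all
  then show ?thesis
    using computable2_swap[OF computable2_rec[OF computable_const computable2_mult, of 1]] by simp
qed

lemma computable_pred: "computable (\<lambda>n. n - 1)"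
proof -
  \<comment> \<open>The step discards the previous value and returns the counter, which is the
    predecessor of the argument.\<close>
  have "evals (PrimRec Zero (Proj 0)) [n] (rec_nat 0 (\<lambda>n _. n) n)" for n
    by (intro evals_PrimRec_rec_nat evals_Proj evals.Zero) simp_all
  moreover have "rec_nat 0 (\<lambda>n _. n) n = n - 1" for n by (cases n) simp_all
  ultimately show ?thesis unfolding computable_def by metis
qed

lemma computable2_diff: "computable2 (-)"
proof -
  have "rec_nat x (\<lambda>_ y. y - 1) n = x - n" for n x :: nat by (induction n) simp_all
  then show ?thesis
    using computable2_swap[OF computable2_rec[OF computable_id computable2_fst[OF computable_pred]]]
    by simp
qed

lemma computable2_max: "computable2 max"
proof -
  have "max = (\<lambda>x y :: nat. x + (y - x))" by (auto simp: fun_eq_iff)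
  then show ?thesis
    using computable2_comp2[OF computable2_add computable2_fst[OF computable_id]
        computable2_swap[OF computable2_diff]] by simp
qed

lemma computable2_min: "computable2 min"
proof -
  have "min = (\<lambda>x y :: nat. x - (x - y))" by (auto simp: fun_eq_iff)
  then show ?thesis
    using computable2_comp2[OF computable2_diff computable2_fst[OF computable_id] computable2_diff]
    by simp
qed

text \<open>The successor keeps the unbounded search for the quotient total.\<close>

lemma computable2_div_Suc: "computable2 (\<lambda>x y. x div Suc y)"
proof -
  obtain p where p: "\<And>x y. evals p [x, y] (x * y)"
    using computable2_mult unfolding computable2_def by blast
  obtain q where q: "\<And>x y. evals q [x, y] (x - y)"
    using computable2_diff unfolding computable2_def by blast
  \<comment> \<open>The truncated difference computed by \<open>h\<close> vanishes exactly when
    \<open>x < Suc k * Suc y\<close>, and the least such \<open>k\<close> is the quotient.\<close>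
  define h where "h = Comp q [Comp Succ [Proj 1], Comp p [Comp Succ [Proj 0], Comp Succ [Proj 2]]]"
  have h: "evals h [k, x, y] (Suc x - Suc k * Suc y)" for k x y
    unfolding h_def
    by (intro evals_Comp2[OF _ _ q] evals_Comp2[OF _ _ p] evals_Comp1[OF _ evals.Succ] evals_Proj)
      simp_all
  have "evals (Mu h) [x, y] (x div Suc y)" for x y
  proof (rule evals.Mu)
    have "x < Suc (x div Suc y) * Suc y"
      by (metis dividend_less_div_times add.commute mult_Suc zero_less_Suc)
    then have "Suc x - Suc (x div Suc y) * Suc y = 0" by linarith
    then show "evals h [x div Suc y, x, y] 0" using h by metis
  next
    fix k assume "k < x div Suc y"
    then have "Suc k * Suc y \<le> x"
      by (metis Suc_leI less_eq_div_iff_mult_less_eq zero_less_Suc)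
    then have "Suc x - Suc k * Suc y = Suc (x - Suc k * Suc y)" by (rule Suc_diff_le)
    then show "\<exists>j. evals h [k, x, y] (Suc j)" using h by metis
  qed
  then show ?thesis unfolding computable2_def by blast
qed

lemmas computable_intros = computable_const computable_id
  computable_comp2[OF computable2_add] computable_comp2[OF computable2_mult]
  computable_comp2[OF computable2_power] computable_comp2[OF computable2_diff]
  computable_comp2[OF computable2_max] computable_comp2[OF computable2_min]

lemma computable_div:
  assumes "computable f" "computable g" "\<And>n. g n \<noteq> 0"
  shows "computable (\<lambda>n. f n div g n)"
proof -
  have "computable (\<lambda>n. f n div Suc (g n - 1))"
    by (intro computable_comp2[OF computable2_div_Suc] computable_intros assms)
  then show ?thesis using assms(3) by simp
qed

section \<open>Computable sequences of nonnegative rationals\<close>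

lemma computable_rat_seq_nat:
  assumes "computable p" "computable q" "\<And>s. q s \<noteq> 0"
  shows "computable_rat_seq (\<lambda>s. of_nat (p s) / of_nat (q s))"
  unfolding computable_rat_seq_def
  by (rule exI[of _ "\<lambda>_. 0"], rule exI[of _ p], rule exI[of _ q])
    (simp add: assms computable_const)

lemma computable_rat_seq_nonnegE:
  assumes "computable_rat_seq a" "\<And>s. 0 \<le> a s"
  obtains p q where "computable p" "computable q" "\<And>s. q s \<noteq> 0"
    "\<And>s. a s = of_nat (p s) / of_nat (q s)"
proof -
  obtain \<sigma> p q where pq: "computable p" "computable q" "\<And>s. q s \<noteq> 0"
    and a: "\<And>s. a s = (- 1) ^ \<sigma> s * (of_nat (p s) / of_nat (q s))"
    using assms(1) unfolding computable_rat_seq_def by blast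
  have "a s = of_nat (p s) / of_nat (q s)" for s
  proof -
    have "0 \<le> (of_nat (p s) / of_nat (q s) :: rat)" by simp
    moreover have "a s = of_nat (p s) / of_nat (q s) \<or> a s = - (of_nat (p s) / of_nat (q s))"
      unfolding a by (cases "even (\<sigma> s)") simp_all
    ultimately show ?thesis using assms(2)[of s] by linarith
  qed
  then show ?thesis using pq that by blast
qed

lemma computable_rat_seq_const:
  assumes "0 \<le> c"
  shows "computable_rat_seq (\<lambda>_. c)"
proof -
  obtain m n :: int where mn: "c = of_int m / of_int n" "0 < n"
    by (metis quotient_of_div quotient_of_denom_pos surj_pair)
  then have "0 \<le> m" using assms by (simp add: zero_le_divide_iff)
  then have "c = of_nat (nat m) / of_nat (nat n)" using mn by simp
  moreover have "nat n \<noteq> 0" using mn(2) by simp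
  ultimately show ?thesis
    using computable_rat_seq_nat[OF computable_const computable_const] by metis
qed

section \<open>Left endpoints of a test, sped up by the successor function\<close>

section \<open>From a test to a speedable approximation\<close>

text \<open>A sequence may approach its limit inferior strictly from above, so the bound at
  infinitely many indices needs the slack between \<open>x\<close> and \<open>y\<close>.\<close>

lemma liminf_less_imp_frequently:
  assumes "liminf X \<le> ereal x" "x < y"
  shows "\<exists>\<^sub>F n in sequentially. X n < ereal y"
proof (rule ccontr)
  assume "\<not> ?thesis"
  then have "\<forall>\<^sub>F n in sequentially. ereal y \<le> X n" by (simp add: not_frequently not_less)
  then have "ereal y \<le> liminf X" by (rule Liminf_bounded)
  then have "ereal y \<le> ereal x" using assms(1) by (rule order_trans)
  then show False using assms(2) by simp
qed

lemma frequently_imp_liminf_le: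
  fixes X :: "nat \<Rightarrow> ereal"
  assumes "\<exists>\<^sub>F n in sequentially. X n \<le> x"
  shows "liminf X \<le> x"
proof (rule ccontr)
  assume "\<not> ?thesis"
  then have "\<forall>\<^sub>F n in sequentially. x < X n" by (intro less_LiminfD) simp
  then show False using assms by (simp add: frequently_def not_le)
qed

lemma frequently_sequentially_iff_infinite:
  "(\<exists>\<^sub>F n in sequentially. P n) \<longleftrightarrow> infinite {n :: nat. P n}"
  by (simp add: cofinite_eq_sequentially[symmetric] frequently_cofinite)

lemma test_imp_left_ce_speedable:
  assumes test: "solovay_test l r" and inc: "bounded_increments l r" and cov: "covered_by \<alpha> l r"
  shows "left_ce_speedable \<alpha>"
proof -
  obtain d where d: "0 < d" "\<And>i. l i + d * (r i - l i) \<le> l (Suc i)"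
    using inc unfolding bounded_increments_def by blast
  have lr: "0 \<le> l i" "l i \<le> r i" "r i \<le> 1" for i
    using test unfolding solovay_test_def by auto
  have "l i \<le> l (Suc i)" for i
    using d(2)[of i] mult_nonneg_nonneg[of d "r i - l i"] d(1) lr(2)[of i] by linarith
  then have mono: "mono l" by (rule monoI[OF lift_Suc_mono_le])
  have freq: "\<exists>\<^sub>F i in sequentially. real_of_rat (l i) \<le> \<alpha> \<and> \<alpha> \<le> real_of_rat (r i)"
    using cov unfolding covered_by_def by (simp add: frequently_sequentially_iff_infinite)
  have mono': "mono (\<lambda>i. real_of_rat (l i))"
    using mono by (simp add: mono_def of_rat_less_eq)
  \<comment> \<open>Some later interval contains \<alpha>, and its left endpoint dominates
    \<open>l i\<close>.\<close>
  have below: "real_of_rat (l i) \<le> \<alpha>" for i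
  proof -
    obtain j where "j \<ge> i" "real_of_rat (l j) \<le> \<alpha>"
      using freq unfolding frequently_sequentially by blast
    then show ?thesis using monoD[OF mono'] order_trans by blast
  qed
  \<comment> \<open>Interval lengths tend to 0, so some covering interval has length below
    \<open>e\<close> and puts \<open>l N\<close> within \<open>e\<close> of \<alpha>; monotonicity
    and \<open>below\<close> keep all later \<open>l i\<close> there.\<close>
  have lim: "(\<lambda>i. real_of_rat (l i)) \<longlonglongrightarrow> \<alpha>"
  proof (rule LIMSEQ_I)
    fix e :: real assume "0 < e"
    have "(\<lambda>i. real_of_rat (r i - l i)) \<longlonglongrightarrow> 0"
      using test unfolding solovay_test_def by (intro summable_LIMSEQ_zero) simp
    then have "\<forall>\<^sub>F i in sequentially. real_of_rat (r i - l i) < e"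
      using \<open>0 < e\<close> by (rule order_tendstoD(2))
    with freq have "\<exists>\<^sub>F i in sequentially.
        (real_of_rat (l i) \<le> \<alpha> \<and> \<alpha> \<le> real_of_rat (r i)) \<and> real_of_rat (r i - l i) < e"
      by (rule frequently_eventually_frequently)
    then obtain N where "\<alpha> \<le> real_of_rat (r N)" "real_of_rat (r N - l N) < e"
      using frequently_ex by blast
    then have N: "\<alpha> < real_of_rat (l N) + e" by (simp add: of_rat_diff)
    have "norm (real_of_rat (l i) - \<alpha>) < e" if "i \<ge> N" for i
      using N below[of i] monoD[OF mono' that] by simp
    then show "\<exists>N. \<forall>i\<ge>N. norm (real_of_rat (l i) - \<alpha>) < e" by blast
  qed
  have l1: "l i \<le> 1" for i using lr(2,3)[of i] by linarith
  have "left_ce_approx l \<alpha>"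
    using test lr(1) l1 lim mono
    unfolding left_ce_approx_def computable_approx_def approximates_def solovay_test_def by simp
  moreover have "speedable l \<alpha>"
  proof -
    \<comment> \<open>The increment constant \<open>d\<close> may exceed 1; capping it keeps \<rho>
      nonnegative.\<close>
    define \<rho> where "\<rho> = 1 - min d 1"
    have \<rho>: "0 \<le> \<rho>" "\<rho> < 1" using d(1) by (auto simp: \<rho>_def)
    have "rho_speedable \<rho> l \<alpha>"
    proof (cases "\<alpha> \<in> \<rat>")
      case False
      have "computable_order Suc"
        using computable_Suc unfolding computable_order_def by (auto simp: mono_def)
      moreover have "\<bar>(\<alpha> - real_of_rat (l (Suc i))) / (\<alpha> - real_of_rat (l i))\<bar> \<le> real_of_rat \<rho>"
        if "real_of_rat (l i) \<le> \<alpha> \<and> \<alpha> \<le> real_of_rat (r i)" for i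
      proof -
        have "\<alpha> \<noteq> real_of_rat (l i)" using False by auto
        then have pos: "0 < \<alpha> - real_of_rat (l i)" using that by simp
        have "l i + min d 1 * (r i - l i) \<le> l (Suc i)"
          using d(2)[of i] mult_right_mono[of "min d 1" d "r i - l i"] lr(2)[of i] by simp
        then have "real_of_rat (l i + min d 1 * (r i - l i)) \<le> real_of_rat (l (Suc i))"
          by (simp only: of_rat_less_eq)
        then have "real_of_rat (l i) + real_of_rat (min d 1) * (real_of_rat (r i) - real_of_rat (l i))
            \<le> real_of_rat (l (Suc i))"
          by (simp add: of_rat_add of_rat_mult of_rat_diff)
        moreover have "real_of_rat (min d 1) * (\<alpha> - real_of_rat (l i))
            \<le> real_of_rat (min d 1) * (real_of_rat (r i) - real_of_rat (l i))"
          using that d(1) by (intro mult_left_mono) auto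
        ultimately have "\<alpha> - real_of_rat (l (Suc i)) \<le> real_of_rat \<rho> * (\<alpha> - real_of_rat (l i))"
          by (simp add: \<rho>_def of_rat_diff algebra_simps)
        then show ?thesis
          using pos below[of "Suc i"] by (simp add: divide_le_eq)
      qed
      then have "liminf (\<lambda>i. ereal \<bar>(\<alpha> - real_of_rat (l (Suc i))) / (\<alpha> - real_of_rat (l i))\<bar>)
          \<le> ereal (real_of_rat \<rho>)"
        by (intro frequently_imp_liminf_le frequently_elim1[OF freq]) simp
      ultimately show ?thesis using False unfolding rho_speedable_def by blast
    qed (simp add: rho_speedable_def)
    then show ?thesis using \<rho> unfolding speedable_def by blast
  qed
  ultimately show ?thesis unfolding left_ce_speedable_def by blast
qed

section \<open>Dyadic rounding, progress along iterates, and stretched intervals\<close>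

section \<open>From a speedable approximation to a test\<close>

text \<open>Treats rational and irrational \<alpha> alike from here on: the product form of the
  inequality, unlike the quotient, tolerates \<open>a s\<close> being equal to \<alpha>.\<close>

lemma speedable_imp_frequently:
  assumes "left_ce_speedable \<alpha>" "0 \<le> \<alpha>" "\<alpha> \<le> 1"
  obtains a f and \<rho> :: real where "left_ce_approx a \<alpha>" "computable f" "mono f" "0 < \<rho>" "\<rho> < 1"
    "\<exists>\<^sub>F s in sequentially. \<alpha> - real_of_rat (a (f s)) \<le> \<rho> * (\<alpha> - real_of_rat (a s))"
proof (cases "\<alpha> \<in> \<rat>")
  case True
  then obtain c where c: "\<alpha> = real_of_rat c" by (auto elim: Rats_cases)
  have c01: "0 \<le> c" "c \<le> 1" using assms(2,3) unfolding c by simp_all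
  then have "left_ce_approx (\<lambda>_. c) \<alpha>"
    unfolding left_ce_approx_def computable_approx_def approximates_def c
    by (auto simp: mono_def computable_rat_seq_const)
  then show ?thesis
    \<comment> \<open>Both sides of the inequality are 0, so any factor between 0 and 1 would
      do.\<close>
    by (rule that[OF _ computable_id, of _ "1/2"]) (auto simp: mono_def c)
next
  case False
  obtain a \<rho> f where a: "left_ce_approx a \<alpha>" and \<rho>: "0 \<le> \<rho>" "\<rho> < 1" and f: "computable_order f"
    and lim: "liminf (\<lambda>s. ereal \<bar>(\<alpha> - real_of_rat (a (f s))) / (\<alpha> - real_of_rat (a s))\<bar>)
           \<le> ereal (real_of_rat \<rho>)"
    using assms(1) False unfolding left_ce_speedable_def speedable_def rho_speedable_def by blast
  have conv: "(\<lambda>s. real_of_rat (a s)) \<longlonglongrightarrow> \<alpha>" and "mono a"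
    using a unfolding left_ce_approx_def computable_approx_def approximates_def by auto
  then have "mono (\<lambda>s. real_of_rat (a s))" by (simp add: mono_def of_rat_less_eq)
  then have le: "real_of_rat (a s) \<le> \<alpha>" for s using conv by (rule incseq_le)
  have "real_of_rat (a s) \<noteq> \<alpha>" for s using False by auto
  with le have lt: "real_of_rat (a s) < \<alpha>" for s by (simp add: less_le)
  have "real_of_rat \<rho> < 1" using \<rho>(2) by simp
  \<comment> \<open>Enlarging \<rho> gives the slack that the limit inferior demands, and makes the
    factor positive even if \<rho> is 0.\<close>
  then obtain \<rho>' where less: "real_of_rat \<rho> < \<rho>'" "\<rho>' < 1" using dense by blast
  have "0 \<le> real_of_rat \<rho>" using \<rho>(1) by simp
  then have "0 < \<rho>'" using less(1) by (rule le_less_trans)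
  have "\<exists>\<^sub>F s in sequentially. \<alpha> - real_of_rat (a (f s)) \<le> \<rho>' * (\<alpha> - real_of_rat (a s))"
  proof (rule frequently_elim1[OF liminf_less_imp_frequently[OF lim less(1)]])
    fix s assume "ereal \<bar>(\<alpha> - real_of_rat (a (f s))) / (\<alpha> - real_of_rat (a s))\<bar> < ereal \<rho>'"
    then show "\<alpha> - real_of_rat (a (f s)) \<le> \<rho>' * (\<alpha> - real_of_rat (a s))"
      using lt[of s] lt[of "f s"] by (simp add: divide_less_eq)
  qed
  then show ?thesis
    using that a f \<open>0 < \<rho>'\<close> less(2) unfolding computable_order_def by blast
qed

text \<open>Take the floor of \<open>a s\<close> on the grid of mesh \<open>1 / 2 ^ s\<close>, then
  go down one more grid step. That step keeps the result below \<alpha> even if \<open>a s\<close>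
  equals \<alpha>, and leaves a gap that later absorbs rounding errors. It is missing only where the
  floor is 0.\<close>

lemma rounding_down:
  assumes a: "left_ce_approx a \<alpha>" and \<alpha>: "0 < \<alpha>"
  obtains m where "computable m" "mono (\<lambda>s. real (m s) / 2 ^ s)"
    "\<And>s. real (m s) / 2 ^ s < \<alpha>" "\<And>s. real_of_rat (a s) - 2 / 2 ^ s \<le> real (m s) / 2 ^ s"
    "\<forall>\<^sub>F s in sequentially. real (m s) / 2 ^ s \<le> real_of_rat (a s) - 1 / 2 ^ s"
proof -
  have a01: "\<And>s. 0 \<le> a s" and conv: "(\<lambda>s. real_of_rat (a s)) \<longlonglongrightarrow> \<alpha>" and mono: "mono a"
    and comp: "computable_rat_seq a"
    using a unfolding left_ce_approx_def computable_approx_def approximates_def by auto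
  define a' where "a' s = real_of_rat (a s)" for s
  have conv': "a' \<longlonglongrightarrow> \<alpha>" using conv by (simp add: a'_def[abs_def])
  have mono': "mono a'" using mono by (simp add: a'_def mono_def of_rat_less_eq)
  have le: "a' s \<le> \<alpha>" for s using mono' conv' by (rule incseq_le)
  obtain p q where pq: "computable p" "computable q" "\<And>s. q s \<noteq> 0"
    and apq: "\<And>s. a s = of_nat (p s) / of_nat (q s)"
    using computable_rat_seq_nonnegE[OF comp a01] by blast
  have a': "a' s = real (p s) / real (q s)" for s by (simp add: a'_def apq of_rat_divide)
  define M where "M s = p s * 2 ^ s div q s" for s
  \<comment> \<open>Truncated at 0, which is why the gap in \<open>m\<close> below requires
    \<open>M s \<noteq> 0\<close>.\<close>
  define m where "m s = M s - 1" for s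
  have M: "M s = nat \<lfloor>a' s * 2 ^ s\<rfloor>" for s
    using floor_divide_of_nat_eq[of "p s * 2 ^ s" "q s", where 'a = real] by (simp add: M_def a')
  have a'_nonneg: "0 \<le> a' s" for s by (simp add: a')
  have M_bounds: "real (M s) \<le> a' s * 2 ^ s" "a' s * 2 ^ s < real (M s) + 1" for s
    using a'_nonneg[of s] unfolding M by (auto simp: of_nat_nat)
  have m: "real (m s) / 2 ^ s \<le> a' s - 1 / 2 ^ s" if "M s \<noteq> 0" for s
    using M_bounds(1)[of s] that by (simp add: m_def field_simps of_nat_diff)
  show ?thesis
  proof (rule that[of m])
    have "computable (\<lambda>s. M s - 1)"
      unfolding M_def by (intro computable_intros computable_div pq)
    then show "computable m" unfolding m_def .
    show "mono (\<lambda>s. real (m s) / 2 ^ s)"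
    proof (rule incseq_SucI)
      fix s
      have "2 * real (M s) \<le> a' s * 2 ^ Suc s" using M_bounds(1)[of s] by simp
      also have "\<dots> \<le> a' (Suc s) * 2 ^ Suc s" using monoD[OF mono', of s "Suc s"] by simp
      also have "\<dots> < real (M (Suc s)) + 1" by (rule M_bounds)
      \<comment> \<open>Integrality turns the strict bound into this one. Doubling
        \<open>m s\<close> subtracts two units from \<open>2 * M s\<close>, while
        \<open>m (Suc s)\<close> subtracts at most one, so the inequality survives.\<close>
      finally have "2 * M s \<le> M (Suc s)" by linarith
      then have "2 * m s \<le> m (Suc s)" unfolding m_def by linarith
      then have "real (2 * m s) \<le> real (m (Suc s))" by (simp only: of_nat_le_iff)
      then show "real (m s) / 2 ^ s \<le> real (m (Suc s)) / 2 ^ Suc s" by (simp add: field_simps)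
    qed
    show "real (m s) / 2 ^ s < \<alpha>" for s
    proof (cases "M s = 0")
      case False
      have "(0 :: real) < 1 / 2 ^ s" by simp
      then show ?thesis using m[OF False] le[of s] by linarith
    qed (simp add: m_def \<alpha>)
    show "real_of_rat (a s) - 2 / 2 ^ s \<le> real (m s) / 2 ^ s" for s
    proof -
      have "a' s * 2 ^ s - 2 \<le> real (m s)" using M_bounds(2)[of s] by (simp add: m_def)
      then have "(a' s * 2 ^ s - 2) / 2 ^ s \<le> real (m s) / 2 ^ s" by (rule divide_right_mono) simp
      then show ?thesis by (simp add: a'_def[symmetric] diff_divide_distrib)
    qed
    \<comment> \<open>As \<alpha> is positive, \<open>a' s\<close> eventually exceeds the mesh, so
      the floor is nonzero.\<close>
    have "\<forall>\<^sub>F s in sequentially. \<alpha> / 2 < a' s"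
      using \<alpha> by (intro order_tendstoD(1)[OF conv']) simp
    moreover have "\<forall>\<^sub>F s in sequentially. (1 / 2 :: real) ^ s < \<alpha> / 2"
      using \<alpha> by (intro order_tendstoD(2)[OF LIMSEQ_realpow_zero]) simp_all
    ultimately show "\<forall>\<^sub>F s in sequentially. real (m s) / 2 ^ s \<le> real_of_rat (a s) - 1 / 2 ^ s"
    proof eventually_elim
      case (elim s)
      then have "(1 / 2) ^ s < a' s" by linarith
      then have "1 < a' s * 2 ^ s" by (simp add: field_simps)
      then have "M s \<noteq> 0" using M_bounds(2)[of s] by auto
      then show ?case using m unfolding a'_def by blast
    qed
  qed
qed

text \<open>If two consecutive steps each closed less than the fraction \<delta> of the remaining
  distance, more than \<open>(1 - \<delta>)\<^sup>2\<close> of it would be left, hence more than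
  \<open>1 - 2 * \<delta>\<close>. This is where the factor 2 comes from.\<close>

lemma frequently_progress_along_iterates:
  fixes b :: "nat \<Rightarrow> real" and g :: "nat \<Rightarrow> nat"
  assumes b: "mono b" "\<And>s. b s < \<alpha>" and g: "mono g" "\<And>s. s < g s"
    and freq: "\<exists>\<^sub>F s in sequentially. \<alpha> - b (g s) \<le> (1 - 2 * \<delta>) * (\<alpha> - b s)"
    and \<delta>: "0 < \<delta>" "2 * \<delta> < 1"
  shows "\<exists>\<^sub>F i in sequentially. \<delta> * (\<alpha> - b ((g ^^ i) 0)) \<le> b ((g ^^ Suc i) 0) - b ((g ^^ i) 0)"
    (is "\<exists>\<^sub>F i in sequentially. ?P i")
  unfolding frequently_sequentially
proof
  fix N
  define S where "S i = (g ^^ i) 0" for i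
  have SSuc: "S (Suc i) = g (S i)" for i by (simp add: S_def)
  have S: "strict_mono S" by (simp add: strict_mono_Suc_iff SSuc g(2))
  obtain s where s: "S N \<le> s" "\<alpha> - b (g s) \<le> (1 - 2 * \<delta>) * (\<alpha> - b s)"
    using freq unfolding frequently_sequentially by blast
  have "s \<le> S s" using S by (rule strict_mono_imp_increasing)
  also have "S s < S (Suc s)" using S by (simp add: strict_mono_def)
  finally have ex: "s < S (Suc s)" .
  \<comment> \<open>The step of the iteration around \<open>s\<close>, that is
    \<open>S i \<le> s < S (Suc i)\<close>; monotonicity of \<open>g\<close> then gives
    \<open>g s \<le> S (Suc (Suc i))\<close>.\<close>
  define i where "i = (LEAST i. s < S (Suc i))"
  have i1: "s < S (Suc i)" unfolding i_def using ex by (rule LeastI)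
  have i0: "S i \<le> s"
  proof (cases i)
    case (Suc j)
    then show ?thesis using not_less_Least[of j "\<lambda>i. s < S (Suc i)"] unfolding i_def by simp
  qed (simp add: S_def)
  have "N < Suc i" using s(1) i1 S strict_mono_less[of S] by (meson le_less_trans)
  define x where "x j = \<alpha> - b (S j)" for j
  have "g s \<le> S (Suc (Suc i))" unfolding SSuc[of "Suc i"] using g(1) i1 by (simp add: mono_def)
  then have "x (Suc (Suc i)) \<le> \<alpha> - b (g s)" using b(1) by (simp add: x_def mono_def)
  also have "\<dots> \<le> (1 - 2 * \<delta>) * (\<alpha> - b s)" by (rule s(2))
  also have "\<dots> \<le> (1 - 2 * \<delta>) * x i"
    using \<delta> monoD[OF b(1) i0] by (intro mult_left_mono) (auto simp: x_def)
  finally have *: "x (Suc (Suc i)) \<le> (1 - 2 * \<delta>) * x i" .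
  have xpos: "0 < x j" for j using b(2) by (simp add: x_def)
  have "\<delta> * x i \<le> x i - x (Suc i) \<or> \<delta> * x (Suc i) \<le> x (Suc i) - x (Suc (Suc i))"
  proof (rule ccontr)
    assume "\<not> ?thesis"
    then have 1: "(1 - \<delta>) * x i < x (Suc i)" and 2: "(1 - \<delta>) * x (Suc i) < x (Suc (Suc i))"
      by (auto simp: algebra_simps)
    have "(1 - \<delta>) * ((1 - \<delta>) * x i) \<le> (1 - \<delta>) * x (Suc i)"
      using 1 \<delta> by (intro mult_left_mono) auto
    then have "(1 - \<delta>) * ((1 - \<delta>) * x i) < (1 - 2 * \<delta>) * x i" using 2 * by linarith
    moreover have "(1 - \<delta>) * ((1 - \<delta>) * x i) = (1 - 2 * \<delta>) * x i + \<delta>\<^sup>2 * x i"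
      by (simp add: algebra_simps power2_eq_square)
    moreover have "0 \<le> \<delta>\<^sup>2 * x i" using xpos[of i] by simp
    ultimately show False by linarith
  qed
  then have "?P i \<or> ?P (Suc i)" by (simp add: x_def S_def)
  then show "\<exists>i\<ge>N. ?P i" using \<open>N < Suc i\<close> by (meson less_Suc_eq_le le_SucI)
qed

text \<open>Interval \<open>i\<close> starts at \<open>c i\<close> and is \<open>C\<close> times as
  long as the step to \<open>c (Suc i)\<close>, cut off at 1. The cut is harmless because \<alpha>
  is at most 1. An integer \<open>C\<close> keeps right endpoints on the dyadic grid, and
  \<open>1 / C\<close> is the increment constant.\<close>

lemma test_from_dyadic_approx:
  fixes m e :: "nat \<Rightarrow> nat" and C :: nat and \<alpha> :: real
  defines "c \<equiv> (\<lambda>i. real (m i) / 2 ^ e i)"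
  assumes comp: "computable m" "computable e" and e: "mono e" and c: "mono c" "\<And>i. c i \<le> \<alpha>"
    and \<alpha>: "\<alpha> \<le> 1" and C: "0 < C"
    and freq: "\<exists>\<^sub>F i in sequentially. \<alpha> \<le> c i + real C * (c (Suc i) - c i)"
  shows "\<exists>l r. solovay_test l r \<and> bounded_increments l r \<and> covered_by \<alpha> l r"
proof -
  \<comment> \<open>Numerator of \<open>c i\<close> on the grid of \<open>c (Suc i)\<close>; the
    subtraction in the exponent is exact since \<open>e\<close> is monotone.\<close>
  define k where "k i = m i * 2 ^ (e (Suc i) - e i)" for i
  \<comment> \<open>The minimum caps the right endpoint at 1. By \<open>km\<close> the subtraction
    is not truncated.\<close>
  define n where "n i = min (2 ^ e (Suc i)) (k i + C * (m (Suc i) - k i))" for i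
  define l :: "nat \<Rightarrow> rat" where "l i = of_nat (m i) / of_nat (2 ^ e i)" for i
  define r :: "nat \<Rightarrow> rat" where "r i = of_nat (n i) / of_nat (2 ^ e (Suc i))" for i
  have cSuc: "c i \<le> c (Suc i)" for i using c(1) by (simp add: mono_def)
  have c_l: "real_of_rat (l i) = c i" for i by (simp add: l_def c_def of_rat_divide of_rat_power)
  have k: "real (k i) / 2 ^ e (Suc i) = c i" for i
  proof -
    have "e (Suc i) = (e (Suc i) - e i) + e i" using monoD[OF e, of i "Suc i"] by simp
    then have "(2 :: real) ^ e (Suc i) = 2 ^ (e (Suc i) - e i) * 2 ^ e i" by (metis power_add)
    then show ?thesis by (simp add: k_def c_def)
  qed
  have "real (k i) \<le> real (m (Suc i))" for i
    using cSuc[of i] unfolding k[of i, symmetric] by (simp add: c_def divide_le_cancel)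
  then have km: "k i \<le> m (Suc i)" for i by simp
  have r_eq: "real_of_rat (r i) = min 1 (c i + real C * (c (Suc i) - c i))" for i
  proof -
    have "real (n i) = min (2 ^ e (Suc i)) (real (k i) + real C * (real (m (Suc i)) - real (k i)))"
      using km[of i] by (simp add: n_def of_nat_min of_nat_diff)
    moreover have "real_of_rat (r i) = real (n i) / 2 ^ e (Suc i)"
      by (simp add: r_def of_rat_divide of_rat_power)
    ultimately have "real_of_rat (r i)
        = min 1 ((real (k i) + real C * (real (m (Suc i)) - real (k i))) / 2 ^ e (Suc i))"
      by (simp add: min_divide_distrib_right)
    also have "(real (k i) + real C * (real (m (Suc i)) - real (k i))) / 2 ^ e (Suc i)
        = c i + real C * (c (Suc i) - c i)"
      unfolding k[of i, symmetric] by (simp add: c_def add_divide_distrib diff_divide_distrib right_diff_distrib)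
    finally show ?thesis .
  qed
  have c1: "c i \<le> 1" for i using c(2)[of i] \<alpha> by linarith
  have step: "0 \<le> real C * (c (Suc i) - c i)" for i using cSuc by simp
  have len: "real_of_rat (r i - l i) \<le> real C * (c (Suc i) - c i)" for i
    by (simp add: of_rat_diff r_eq c_l)
  have l_le_r: "l i \<le> r i" for i
  proof -
    have "real_of_rat (l i) \<le> real_of_rat (r i)" using c1[of i] step[of i] by (simp add: c_l r_eq)
    then show ?thesis by (simp only: of_rat_less_eq)
  qed
  have r1: "r i \<le> 1" for i
  proof -
    have "real_of_rat (r i) \<le> real_of_rat 1" by (simp add: r_eq)
    then show ?thesis by (simp only: of_rat_less_eq)
  qed
  have dyadic_nat: "dyadic (of_nat x / of_nat (2 ^ y))" for x y
    unfolding dyadic_def by (rule exI[of _ "int x"], rule exI[of _ y]) simp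
  have "solovay_test l r"
    unfolding solovay_test_def
  proof (intro conjI allI)
    show "0 \<le> l i" for i by (simp add: l_def)
    show "dyadic (l i)" "dyadic (r i)" for i unfolding l_def r_def by (rule dyadic_nat)+
    have "computable (\<lambda>i. e (Suc i))" "computable (\<lambda>i. m (Suc i))"
      using comp by (auto intro: computable_comp computable_Suc)
    then show "computable_rat_seq r"
      unfolding r_def n_def k_def by (intro computable_rat_seq_nat computable_intros comp) simp_all
    show "computable_rat_seq l"
      unfolding l_def by (intro computable_rat_seq_nat computable_intros comp) simp_all
    obtain L where "c \<longlonglongrightarrow> L" using incseq_convergent[OF c(1)] c(2) by blast
    then have "summable (\<lambda>i. real C * (c (Suc i) - c i))"
      by (intro summable_mult telescope_summable)
    then show "summable (\<lambda>i. real_of_rat (r i - l i))"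
    proof (rule summable_comparison_test')
      fix i
      have "0 \<le> real_of_rat (r i - l i)" using l_le_r by simp
      then show "norm (real_of_rat (r i - l i)) \<le> real C * (c (Suc i) - c i)" using len by simp
    qed
  qed (fact l_le_r r1)+
  moreover have "bounded_increments l r"
    unfolding bounded_increments_def
  proof (intro exI[of _ "1 / of_nat C"] conjI allI)
    show "0 < (1 / of_nat C :: rat)" using C by simp
    fix i
    have "real_of_rat (l i + 1 / of_nat C * (r i - l i)) \<le> real_of_rat (l (Suc i))"
      using len[of i] C
      by (simp add: of_rat_add of_rat_mult of_rat_divide of_rat_diff c_l field_simps)
    then show "l i + 1 / of_nat C * (r i - l i) \<le> l (Suc i)" by (simp only: of_rat_less_eq)
  qed
  moreover have "covered_by \<alpha> l r"
    unfolding covered_by_def frequently_sequentially_iff_infinite[symmetric]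
    by (rule frequently_elim1[OF freq]) (use \<alpha> c(2) in \<open>simp add: c_l r_eq\<close>)
  ultimately show ?thesis by blast
qed

lemma left_ce_speedable_imp_test:
  assumes speed: "left_ce_speedable \<alpha>" and \<alpha>: "0 < \<alpha>" "\<alpha> < 1"
  shows "\<exists>l r. solovay_test l r \<and> bounded_increments l r \<and> covered_by \<alpha> l r"
proof -
  obtain a f and \<rho> :: real where a: "left_ce_approx a \<alpha>" and f: "computable f" "mono f"
    and \<rho>: "0 < \<rho>" "\<rho> < 1"
    and freq: "\<exists>\<^sub>F s in sequentially. \<alpha> - real_of_rat (a (f s)) \<le> \<rho> * (\<alpha> - real_of_rat (a s))"
    by (rule speedable_imp_frequently[OF speed]) (use \<alpha> in auto)
  obtain m where m: "computable m" "mono (\<lambda>s. real (m s) / 2 ^ s)"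
    "\<And>s. real (m s) / 2 ^ s < \<alpha>" "\<And>s. real_of_rat (a s) - 2 / 2 ^ s \<le> real (m s) / 2 ^ s"
    "\<forall>\<^sub>F s in sequentially. real (m s) / 2 ^ s \<le> real_of_rat (a s) - 1 / 2 ^ s"
    using rounding_down[OF a \<alpha>(1)] by blast
  define b where "b s = real (m s) / 2 ^ s" for s
  have "mono a" using a by (simp add: left_ce_approx_def)
  \<comment> \<open>Chosen so that the rounding error at stage \<open>g s\<close>, at most
    \<open>2 / 2 ^ g s\<close>, is at most \<open>\<rho> / 2 ^ s\<close>.\<close>
  obtain K where K: "(1 / 2) ^ K < \<rho> / 2" using real_arch_pow_inv[of "\<rho> / 2" "1 / 2"] \<rho> by auto
  define g where "g s = max (f s) (s + Suc K)" for s
  have "computable g" unfolding g_def by (intro computable_intros f)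
  have less_g: "s < g s" for s by (simp add: g_def less_max_iff_disj)
  have "mono g" using f(2) unfolding g_def mono_def by (meson add_right_mono max.mono)
  define \<delta> where "\<delta> = (1 - \<rho>) / 2"
  have \<delta>: "0 < \<delta>" "2 * \<delta> < 1" "1 - 2 * \<delta> = \<rho>" using \<rho> by (auto simp: \<delta>_def field_simps)
  have "\<exists>\<^sub>F s in sequentially. \<alpha> - b (g s) \<le> (1 - 2 * \<delta>) * (\<alpha> - b s)"
    using frequently_eventually_frequently[OF freq m(5)]
  proof (rule frequently_elim1, elim conjE)
    fix s
    assume s: "\<alpha> - real_of_rat (a (f s)) \<le> \<rho> * (\<alpha> - real_of_rat (a s))"
      "real (m s) / 2 ^ s \<le> real_of_rat (a s) - 1 / 2 ^ s"
    have "(2 :: real) / 2 ^ g s \<le> 2 / 2 ^ (s + K)"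
      by (intro divide_left_mono power_increasing) (auto simp: g_def)
    also have "\<dots> = 2 * (1 / 2) ^ K / 2 ^ s" by (simp add: power_add field_simps)
    also have "\<dots> \<le> \<rho> / 2 ^ s" using K by (intro divide_right_mono) auto
    finally have g: "2 / 2 ^ g s \<le> \<rho> / 2 ^ s" .
    have "a (f s) \<le> a (g s)" using \<open>mono a\<close> by (simp add: g_def mono_def)
    then have "real_of_rat (a (f s)) \<le> real_of_rat (a (g s))" by (simp only: of_rat_less_eq)
    then have "\<alpha> - b (g s) \<le> \<rho> * (\<alpha> - real_of_rat (a s)) + \<rho> / 2 ^ s"
      using m(4)[of "g s"] s(1) g unfolding b_def by linarith
    \<comment> \<open>The rounding error at \<open>g s\<close> is charged to the gap of
      \<open>1 / 2 ^ s\<close> between \<open>b s\<close> and \<open>a s\<close>, so the factor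
      \<rho> is not worsened.\<close>
    also have "\<dots> = \<rho> * (\<alpha> - (real_of_rat (a s) - 1 / 2 ^ s))" by (simp add: algebra_simps)
    also have "\<dots> \<le> \<rho> * (\<alpha> - b s)" using s(2) \<rho> by (intro mult_left_mono) (auto simp: b_def)
    also have "\<dots> = (1 - 2 * \<delta>) * (\<alpha> - b s)" by (simp only: \<delta>(3))
    finally show "\<alpha> - b (g s) \<le> (1 - 2 * \<delta>) * (\<alpha> - b s)" .
  qed
  then have freq': "\<exists>\<^sub>F i in sequentially.
      \<delta> * (\<alpha> - b ((g ^^ i) 0)) \<le> b ((g ^^ Suc i) 0) - b ((g ^^ i) 0)"
    by (rule frequently_progress_along_iterates[rotated 4])
      (use m(2,3) \<delta> \<open>mono g\<close> in \<open>auto simp: b_def less_g\<close>)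
  \<comment> \<open>The iterates serve both as stages and as exponents of the dyadic
    denominators.\<close>
  define e where "e i = (g ^^ i) 0" for i
  have "computable e" unfolding e_def by (rule computable_funpow) fact
  have "mono e" by (rule incseq_SucI) (simp add: e_def less_imp_le[OF less_g])
  \<comment> \<open>Stretching a step that closes the fraction \<delta> of the distance by at least
    \<open>1 / \<delta>\<close> reaches \<alpha>.\<close>
  obtain C where C: "1 / \<delta> \<le> real C" using real_arch_simple by blast
  have "0 < 1 / \<delta>" using \<delta>(1) by simp
  then have "0 < C" using C by (metis less_le_trans of_nat_0_less_iff)
  have "\<exists>\<^sub>F i in sequentially. \<alpha> \<le> b (e i) + real C * (b (e (Suc i)) - b (e i))"
    using freq'
  proof (rule frequently_elim1)
    fix i
    assume "\<delta> * (\<alpha> - b ((g ^^ i) 0)) \<le> b ((g ^^ Suc i) 0) - b ((g ^^ i) 0)"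
    then have i: "\<delta> * (\<alpha> - b (e i)) \<le> b (e (Suc i)) - b (e i)" by (simp add: e_def)
    have "1 \<le> real C * \<delta>" using C \<delta>(1) by (simp add: divide_le_eq)
    then have "1 * (\<alpha> - b (e i)) \<le> real C * \<delta> * (\<alpha> - b (e i))"
      using m(3)[of "e i"] by (intro mult_right_mono) (auto simp: b_def)
    also have "\<dots> \<le> real C * (b (e (Suc i)) - b (e i))"
      using mult_left_mono[OF i, of "real C"] by (simp add: mult.assoc)
    finally show "\<alpha> \<le> b (e i) + real C * (b (e (Suc i)) - b (e i))" by simp
  qed
  moreover have "mono (\<lambda>i. b (e i))"
    using m(2) \<open>mono e\<close> unfolding b_def mono_def by blast
  moreover have "computable (\<lambda>i. m (e i))" using m(1) \<open>computable e\<close> by (rule computable_comp)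
  ultimately show ?thesis
    using test_from_dyadic_approx[of "\<lambda>i. m (e i)" e \<alpha> C] \<open>computable e\<close> \<open>mono e\<close> \<open>0 < C\<close> \<alpha>(2)
      m(3) less_imp_le unfolding b_def by blast
qed

theorem proposition4p5:
  fixes \<alpha> :: real
  assumes "0 < \<alpha>" and "\<alpha> < 1"
  shows "left_ce_speedable \<alpha> \<longleftrightarrow>
    (\<exists>l r. solovay_test l r \<and> bounded_increments l r \<and> covered_by \<alpha> l r)"
  using left_ce_speedable_imp_test test_imp_left_ce_speedable assms by blast

end
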